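(* Let $(S,\mathcal{C},r)$ be a semimatroid of rank $r$ and fix a linear order on $S$. Then $$T_{\mathcal{C}}(q,t)=\sum_{B \text{ basis of } \mathcal{C}} q^{i(B)}\,t^{e(B)},$$ where $i(B)$ and $e(B)$ denote the internal and external activity of the basis $B$ with respect to the fixed order, and $T_{\mathcal{C}}$ is the Tutte polynomial of the semimatroid.
   Context: $\mathbb{N}$ includes $0$. A simplicial complex on a finite set $S$ is a family of subsets of $S$ closed under taking subsets; singletons need not belong to it. A semimatroid is a triple $(S,\mathcal{C},r_{\mathcal{C}})$ consisting of a finite set $S$, a non-empty simplicial complex $\mathcal{C}$ on $S$, and a function $r_{\mathcal{C}}:\mathcal{C}\to\mathbb{N}$ such that: (R1) if $X\in\mathcal{C}$ then $0\le r_{\mathcal{C}}(X)\le |X|$; (R2) if $X,Y\in\mathcal{C}$ and $X\subseteq Y$ then $r_{\mathcal{C}}(X)\le r_{\mathcal{C}}(Y)$; (R3) if $X,Y\in\mathcal{C}$ and $X\cup Y\in\mathcal{C}$ then $r_{\mathcal{C}}(X)+r_{\mathcal{C}}(Y)\ge r_{\mathcal{C}}(X\cup Y)+r_{\mathcal{C}}(X\cap Y)$; (CR1) if $X,Y\in\mathcal{C}$ and $r_{\mathcal{C}}(X)=r_{\mathcal{C}}(X\cap Y)$ then $X\cup Y\in\mathcal{C}$; (CR2) if $X,Y\in\mathcal{C}$ and $r_{\mathcal{C}}(X)<r_{\mathcal{C}}(Y)$ then $X\cup\{y\}\in\mathcal{C}$ for some $y\in Y-X$. All maximal sets of $\mathcal{C}$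 have the same rank, called the rank of the semimatroid and also denoted $r$. The rank function extends to all $X\subseteq S$ by $r(X)=\max\{r_{\mathcal{C}}(Y)\mid Y\subseteq X,\ Y\in\mathcal{C}\}$, which is a matroid rank function. The Tutte polynomial is $T_{\mathcal{C}}(x,y)=\sum_{X\in\mathcal{C}}(x-1)^{r-r(X)}(y-1)^{|X|-r(X)}$. A basis of $\mathcal{C}$ is a set $B\in\mathcal{C}$ with $|B|=r(B)=r$. A set $X\in\mathcal{C}$ is dependent if $r(X)<|X|$; a circuit is a minimal dependent set in $\mathcal{C}$. A cocircuit is a minimal subset $D\subseteq S$ with $r(S-D)<r$. If $B$ is a basis, $e\notin B$ and $B\cup\{e\}\in\mathcal{C}$, then $B\cup\{e\}$ contains a unique circuit; if $i\in B$, then $(S-B)\cup\{i\}$ contains a unique cocircuit. An element $e\notin B$ is externally active for $B$ if $B\cup\{e\}\in\mathcal{C}$ and $e$ is the smallest element (in the linear order) of the unique circuit in $B\cup\{e\}$; $e(B)$ is the number of externally active elements. An element $i\in B$ is internally active in $B$ if $i$ is the smallest element of the unique cocircuit in $(S-B)\cup\{i\}$; $i(B)$ is the number of internally active elements. *)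

theory Defs
  imports Main
begin

text \<open>
  The rank function of a semimatroid is only defined on the members of \<open>\<C>\<close>; here \<open>\<rho>\<close> is total
  and its values outside \<open>\<C>\<close> are irrelevant. The lower bound in (R1) is implicit in the type
  \<^typ>\<open>nat\<close>.
\<close>

locale semimatroid =
  fixes S :: "'a set"
    and \<C> :: "'a set set"
    and \<rho> :: "'a set \<Rightarrow> nat"
  assumes finite_ground: "finite S"
    and subset_ground: "X \<in> \<C> \<Longrightarrow> X \<subseteq> S"
    and nonempty: "\<C> \<noteq> {}"
    and down_closed: "X \<in> \<C> \<Longrightarrow> Y \<subseteq> X \<Longrightarrow> Y \<in> \<C>"
    and R1: "X \<in> \<C> \<Longrightarrow> \<rho> X \<le> card X"
    and R2: "X \<in> \<C> \<Longrightarrow> Y \<in> \<C> \<Longrightarrow> X \<subseteq> Y \<Longrightarrow> \<rho> X \<le> \<rho> Y"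
    and R3: "X \<in> \<C> \<Longrightarrow> Y \<in> \<C> \<Longrightarrow> X \<union> Y \<in> \<C> \<Longrightarrow> \<rho> X + \<rho> Y \<ge> \<rho> (X \<union> Y) + \<rho> (X \<inter> Y)"
    and CR1: "X \<in> \<C> \<Longrightarrow> Y \<in> \<C> \<Longrightarrow> \<rho> X = \<rho> (X \<inter> Y) \<Longrightarrow> X \<union> Y \<in> \<C>"
    and CR2: "X \<in> \<C> \<Longrightarrow> Y \<in> \<C> \<Longrightarrow> \<rho> X < \<rho> Y \<Longrightarrow> \<exists>y \<in> Y - X. X \<union> {y} \<in> \<C>"
begin

definition maximal :: "'a set \<Rightarrow> bool" where
  "maximal X \<longleftrightarrow> X \<in> \<C> \<and> (\<forall>Y \<in> \<C>. X \<subseteq> Y \<longrightarrow> Y = X)"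

text \<open>The common rank of the maximal members of \<open>\<C>\<close>; see \<open>rank_maximal\<close> below.\<close>

definition rank :: nat where
  "rank = (THE n. \<forall>X. maximal X \<longrightarrow> \<rho> X = n)"

text \<open>
  The extension of \<open>\<rho>\<close> to all subsets of \<open>S\<close>. It agrees with \<open>\<rho>\<close> on \<open>\<C>\<close> (\<open>r_eq\<close> below), so the
  definitions that only concern members of \<open>\<C>\<close> use \<open>\<rho>\<close>.
\<close>

definition r :: "'a set \<Rightarrow> nat" where
  "r X = Max {\<rho> Y | Y. Y \<subseteq> X \<and> Y \<in> \<C>}"

text \<open>
  The arguments range over an arbitrary commutative ring. The bivariate polynomial itself is the
  value at the two indeterminates of \<open>\<int>[x,y]\<close>, and any other value is an evaluation of it.
  No subtraction on \<^typ>\<open>nat\<close> truncates here, by \<open>rank_ge\<close> below and (R1).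
\<close>

definition tutte :: "'b::comm_ring_1 \<Rightarrow> 'b \<Rightarrow> 'b" where
  "tutte x y = (\<Sum>X\<in>\<C>. (x - 1) ^ (rank - \<rho> X) * (y - 1) ^ (card X - \<rho> X))"

definition basis :: "'a set \<Rightarrow> bool" where
  "basis B \<longleftrightarrow> B \<in> \<C> \<and> card B = \<rho> B \<and> \<rho> B = rank"

definition dependent :: "'a set \<Rightarrow> bool" where
  "dependent X \<longleftrightarrow> X \<in> \<C> \<and> \<rho> X < card X"

definition circuit :: "'a set \<Rightarrow> bool" where
  "circuit K \<longleftrightarrow> dependent K \<and> (\<forall>X. dependent X \<and> X \<subseteq> K \<longrightarrow> X = K)"

definition cocircuit :: "'a set \<Rightarrow> bool" where
  "cocircuit D \<longleftrightarrow> D \<subseteq> S \<and> r (S - D) < rank \<and>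
     (\<forall>D' \<subseteq> D. r (S - D') < rank \<longrightarrow> D' = D)"

definition fund_circuit :: "'a set \<Rightarrow> 'a \<Rightarrow> 'a set" where
  "fund_circuit B e = (THE K. circuit K \<and> K \<subseteq> B \<union> {e})"

definition fund_cocircuit :: "'a set \<Rightarrow> 'a \<Rightarrow> 'a set" where
  "fund_cocircuit B i = (THE D. cocircuit D \<and> D \<subseteq> (S - B) \<union> {i})"

text \<open>\<open>(a, b) \<in> le\<close> means that \<open>a\<close> is at most \<open>b\<close> in the linear order on \<open>S\<close>.\<close>

definition smallest :: "'a rel \<Rightarrow> 'a set \<Rightarrow> 'a \<Rightarrow> bool" where
  "smallest le A a \<longleftrightarrow> a \<in> A \<and> (\<forall>b \<in> A. (a, b) \<in> le)"

definition ext_active :: "'a rel \<Rightarrow> 'a set \<Rightarrow> 'a \<Rightarrow> bool" where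
  "ext_active le B e \<longleftrightarrow>
     e \<in> S - B \<and> B \<union> {e} \<in> \<C> \<and> smallest le (fund_circuit B e) e"

definition int_active :: "'a rel \<Rightarrow> 'a set \<Rightarrow> 'a \<Rightarrow> bool" where
  "int_active le B i \<longleftrightarrow> i \<in> B \<and> smallest le (fund_cocircuit B i) i"

definition ext_activity :: "'a rel \<Rightarrow> 'a set \<Rightarrow> nat" where
  "ext_activity le B = card {e. ext_active le B e}"

definition int_activity :: "'a rel \<Rightarrow> 'a set \<Rightarrow> nat" where
  "int_activity le B = card {i. int_active le B i}"

lemma finite_complex: "finite \<C>"
proof (rule finite_subset)
  show "\<C> \<subseteq> Pow S" using subset_ground by blast
  show "finite (Pow S)" using finite_ground by simp
qed

lemma ex_maximal:
  assumes "X \<in> \<C>"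
  shows "\<exists>M. maximal M \<and> X \<subseteq> M"
proof -
  obtain M where "M \<in> \<C>" "X \<subseteq> M" "\<forall>Y \<in> \<C>. M \<subseteq> Y \<longrightarrow> M = Y"
    using finite_has_maximal2[OF finite_complex assms] by metis
  then show ?thesis unfolding maximal_def by metis
qed

lemma maximal_rank_le:
  assumes "maximal X" "maximal Y"
  shows "\<rho> Y \<le> \<rho> X"
proof (rule ccontr)
  assume "\<not> \<rho> Y \<le> \<rho> X"
  with assms obtain y where "y \<in> Y - X" "X \<union> {y} \<in> \<C>"
    using CR2[of X Y] by (auto simp: maximal_def not_le)
  moreover from this have "X \<union> {y} = X"
    using assms(1) unfolding maximal_def by (metis Un_upper1)
  ultimately show False by auto
qed

lemma rank_maximal:
  assumes "maximal X"
  shows "\<rho> X = rank"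
proof -
  have "rank = \<rho> X"
    unfolding rank_def
  proof (rule the_equality)
    show "\<forall>Y. maximal Y \<longrightarrow> \<rho> Y = \<rho> X"
      using maximal_rank_le assms by (metis le_antisym)
  qed (use assms in simp)
  then show ?thesis by simp
qed

lemma rank_ge:
  assumes "X \<in> \<C>"
  shows "\<rho> X \<le> rank"
proof -
  obtain M where M: "maximal M" "X \<subseteq> M" using ex_maximal[OF assms] by (elim exE conjE)
  then have "\<rho> X \<le> \<rho> M" using R2[OF assms, of M] by (simp add: maximal_def)
  with rank_maximal[OF M(1)] show ?thesis by simp
qed

lemma r_eq:
  assumes "X \<in> \<C>"
  shows "r X = \<rho> X"
  unfolding r_def
proof (rule Max_eqI)
  show "finite {\<rho> Y | Y. Y \<subseteq> X \<and> Y \<in> \<C>}"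
    using finite_complex by simp
  show "\<rho> X \<in> {\<rho> Y | Y. Y \<subseteq> X \<and> Y \<in> \<C>}"
    using assms by (intro CollectI exI[of _ X]) simp
  fix n assume "n \<in> {\<rho> Y | Y. Y \<subseteq> X \<and> Y \<in> \<C>}"
  then obtain Y where "n = \<rho> Y" "Y \<subseteq> X" "Y \<in> \<C>" by (elim CollectE exE conjE)
  then show "n \<le> \<rho> X" using R2[of Y X] assms by simp
qed

end

end

theory Submission
  imports Defs
begin

text \<open>
  Call a basis optimal for an injective weight if every basis exchange strictly increases the weight;
  there is exactly one optimal basis. Crapo's partition comes from the following weight: for
  \<open>X \<in> \<C>\<close>, elements of \<open>X\<close> precede those outside \<open>X\<close>, the order being reversed within \<open>X\<close>
  and kept outside of it. A basis \<open>B\<close> is optimal for this weight if and only if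
  \<open>B - X\<close> consists of internally active and \<open>X - B\<close> of externally active elements.
  So \<open>\<C>\<close> is the disjoint union, over the bases \<open>B\<close>, of the sets \<open>(B - I) \<union> E\<close> with \<open>I\<close>
  internally and \<open>E\<close> externally active, and each of these contributes
  \<open>(q - 1) ^ card I * (t - 1) ^ card E\<close>.
\<close>

section \<open>Integer encoding of the order and a binomial sum\<close>

lemma linear_order_weight:
  assumes "finite S" "linear_order_on S le"
  obtains p :: "'a \<Rightarrow> int"
  where "\<And>a. a \<in> S \<Longrightarrow> 0 < p a"
    and "\<And>a b. a \<in> S \<Longrightarrow> b \<in> S \<Longrightarrow> (a, b) \<in> le \<longleftrightarrow> p a \<le> p b"
    and "inj_on p S"
proof -
  have refl: "(a, a) \<in> le" if "a \<in> S" for a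
    using assms(2) that by (auto simp: order_on_defs refl_on_def)
  have trans: "(a, c) \<in> le" if "(a, b) \<in> le" "(b, c) \<in> le" for a b c
    using assms(2) that by (auto simp: order_on_defs dest: transD)
  have antisym: "a = b" if "(a, b) \<in> le" "(b, a) \<in> le" for a b
    using assms(2) that by (auto simp: order_on_defs dest: antisymD)
  have total: "(a, b) \<in> le \<or> (b, a) \<in> le" if "a \<in> S" "b \<in> S" for a b
    using assms(2) that refl by (cases "a = b") (auto simp: order_on_defs total_on_def)
  \<comment> \<open>The encoding is by sizes of initial segments; \<open>a\<close> belongs to its
    own segment, which makes the values positive.\<close>
  define L where "L a = {y \<in> S. (y, a) \<in> le}" for a
  have fin: "finite (L a)" for a using assms(1) by (simp add: L_def)
  have mono: "card (L a) \<le> card (L b)" if "(a, b) \<in> le" for a b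
    using that trans by (intro card_mono fin) (auto simp: L_def)
  have strict: "card (L a) < card (L b)" if "(a, b) \<in> le" "a \<noteq> b" "b \<in> S" for a b
  proof -
    have "L a \<subseteq> L b" "b \<in> L b" "b \<notin> L a"
      using that trans refl antisym by (auto simp: L_def)
    then show ?thesis by (intro psubset_card_mono fin) blast
  qed
  show ?thesis
  proof (rule that[of "\<lambda>a. int (card (L a))"])
    show "0 < int (card (L a))" if "a \<in> S" for a
      using that refl fin[of a] by (auto simp: card_gt_0_iff L_def)
    show iff: "(a, b) \<in> le \<longleftrightarrow> int (card (L a)) \<le> int (card (L b))"
      if "a \<in> S" "b \<in> S" for a b
      using mono[of a b] strict[of b a] total[of a b] that by fastforce
    show "inj_on (\<lambda>a. int (card (L a))) S"
      using iff antisym by (intro inj_onI) simp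
  qed
qed

lemma maximal_memberE:
  fixes A :: "'a set set"
  assumes "finite A" "a \<in> A"
  obtains m where "m \<in> A" "a \<subseteq> m" "\<And>b. b \<in> A \<Longrightarrow> m \<subseteq> b \<Longrightarrow> b = m"
  using finite_has_maximal2[OF assms] by (elim bexE conjE) auto

text \<open>Expanding the product of \<open>(q - 1) + 1\<close> over \<open>A\<close> chooses a
  summand at each element; \<open>I\<close> is the set where \<open>q - 1\<close> is chosen.\<close>

lemma sum_Pow_power_card:
  fixes q :: "'b::comm_ring_1"
  assumes "finite A"
  shows "(\<Sum>I\<in>Pow A. (q - 1) ^ card I) = q ^ card A"
proof -
  have "q ^ card A = (\<Prod>a\<in>A. (q - 1) + 1)" by simp
  also have "\<dots> = (\<Sum>I\<in>Pow A. (\<Prod>a\<in>I. q - 1) * (\<Prod>a\<in>A - I. 1))"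
    by (rule prod_add[OF assms])
  finally show ?thesis by simp
qed

section \<open>Independent sets and augmentation\<close>

context semimatroid
begin

definition indep :: "'a set \<Rightarrow> bool" where
  "indep I \<longleftrightarrow> I \<in> \<C> \<and> \<rho> I = card I"

definition optimal :: "('a \<Rightarrow> int) \<Rightarrow> 'a set \<Rightarrow> bool" where
  "optimal w B \<longleftrightarrow> basis B \<and>
     (\<forall>b\<in>B. \<forall>x. x \<notin> B \<and> basis (insert x (B - {b})) \<longrightarrow> w b < w x)"

lemma finite_member: "X \<in> \<C> \<Longrightarrow> finite X"
  using subset_ground finite_ground finite_subset by blast

text \<open>Elements of \<open>Z - X\<close> join one at a time: \<open>insert z X\<close> and
  \<open>X \<union> F\<close> meet in \<open>X\<close>, so (R3) bounds the rank of their union by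
  \<open>\<rho> X\<close>. All these sets lie in \<open>Z\<close>, hence in
  \<open>\<C>\<close>.\<close>

lemma rank_insert_constant:
  assumes "Z \<in> \<C>" "X \<subseteq> Z" "\<And>z. z \<in> Z - X \<Longrightarrow> \<rho> (insert z X) = \<rho> X"
  shows "\<rho> Z = \<rho> X"
proof -
  have "\<rho> (X \<union> F) = \<rho> X" if "F \<subseteq> Z - X" "finite F" for F
    using that(2,1)
  proof induction
    case (insert z F)
    have "insert z X \<in> \<C>" "X \<union> F \<in> \<C>" "insert z X \<union> (X \<union> F) \<in> \<C>" "X \<in> \<C>"
      "X \<union> insert z F \<in> \<C>"
      using insert.prems assms(1,2) by (auto intro: down_closed)
    moreover have "insert z X \<union> (X \<union> F) = X \<union> insert z F" "insert z X \<inter> (X \<union> F) = X"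
      using insert by auto
    moreover have "\<rho> (X \<union> F) = \<rho> X" "\<rho> (insert z X) = \<rho> X"
      using insert assms(3)[of z] by auto
    ultimately have "\<rho> (X \<union> insert z F) \<le> \<rho> X" "\<rho> X \<le> \<rho> (X \<union> insert z F)"
      using R3[of "insert z X" "X \<union> F"] R2[of X "X \<union> insert z F"] by auto
    then show ?case by simp
  qed simp
  from this[of "Z - X"] show ?thesis
    using finite_member[OF assms(1)] assms(2) by (simp add: Un_absorb1)
qed

text \<open>Sharpens (CR2): the new element also raises the rank. By (CR2) a maximal member
  \<open>Z\<close> between \<open>X\<close> and \<open>X \<union> Y\<close> has rank at least
  \<open>\<rho> Y\<close>, so by \<open>rank_insert_constant\<close> some single element of
  \<open>Z - X\<close> changes the rank.\<close>

lemma augment_step: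
  assumes "X \<in> \<C>" "Y \<in> \<C>" "\<rho> X < \<rho> Y"
  obtains y where "y \<in> Y - X" "insert y X \<in> \<C>" "\<rho> X < \<rho> (insert y X)"
proof -
  have "finite {Z \<in> \<C>. X \<subseteq> Z \<and> Z \<subseteq> X \<union> Y}" using finite_complex by simp
  moreover have "X \<in> {Z \<in> \<C>. X \<subseteq> Z \<and> Z \<subseteq> X \<union> Y}" using assms by simp
  ultimately obtain Z where "Z \<in> {Z \<in> \<C>. X \<subseteq> Z \<and> Z \<subseteq> X \<union> Y}" "X \<subseteq> Z"
    and max: "\<And>Z'. Z' \<in> {Z \<in> \<C>. X \<subseteq> Z \<and> Z \<subseteq> X \<union> Y} \<Longrightarrow> Z \<subseteq> Z' \<Longrightarrow> Z' = Z"
    by (rule maximal_memberE) blast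
  then have Z: "Z \<in> \<C>" "X \<subseteq> Z" "Z \<subseteq> X \<union> Y" by auto
  have "\<rho> Y \<le> \<rho> Z"
  proof (rule ccontr)
    assume "\<not> \<rho> Y \<le> \<rho> Z"
    then obtain y where "y \<in> Y - Z" "Z \<union> {y} \<in> \<C>" using CR2 Z(1) assms(2) by (metis not_le)
    with max[of "Z \<union> {y}"] Z show False by auto
  qed
  then obtain z where z: "z \<in> Z - X" "\<rho> (insert z X) \<noteq> \<rho> X"
    using rank_insert_constant[OF Z(1,2)] assms(3) by force
  then have "insert z X \<in> \<C>" using Z by (auto intro: down_closed)
  moreover from this have "\<rho> X \<le> \<rho> (insert z X)" using R2 assms(1) by blast
  ultimately show ?thesis using that[of z] z Z(3) by auto
qed

lemma indep_insert:
  assumes "indep I" "insert y I \<in> \<C>" "\<rho> I < \<rho> (insert y I)"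
  shows "indep (insert y I)"
proof -
  have "card (insert y I) \<le> Suc (card I)" by (simp add: card_insert_le_m1 card_insert_if)
  with assms R1[OF assms(2)] show ?thesis by (simp add: indep_def)
qed

lemma augment:
  assumes "indep I" "Y \<in> \<C>"
  obtains J where "indep J" "I \<subseteq> J" "J \<subseteq> I \<union> Y" "\<rho> Y \<le> \<rho> J"
proof -
  have "finite {J. indep J \<and> I \<subseteq> J \<and> J \<subseteq> I \<union> Y}"
    using finite_complex by (rule rev_finite_subset) (auto simp: indep_def)
  moreover have "I \<in> {J. indep J \<and> I \<subseteq> J \<and> J \<subseteq> I \<union> Y}" using assms by simp
  ultimately obtain J where "J \<in> {J. indep J \<and> I \<subseteq> J \<and> J \<subseteq> I \<union> Y}" "I \<subseteq> J"
    and max: "\<And>J'. J' \<in> {J. indep J \<and> I \<subseteq> J \<and> J \<subseteq> I \<union> Y} \<Longrightarrow> J \<subseteq> J' \<Longrightarrow> J' = J"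
    by (rule maximal_memberE) blast
  then have J: "indep J" "I \<subseteq> J" "J \<subseteq> I \<union> Y" by auto
  have "\<rho> Y \<le> \<rho> J"
  proof (rule ccontr)
    assume "\<not> \<rho> Y \<le> \<rho> J"
    then obtain y where y: "y \<in> Y - J" "insert y J \<in> \<C>" "\<rho> J < \<rho> (insert y J)"
      using augment_step J(1) assms(2) by (metis indep_def not_le)
    then have "indep (insert y J)" using indep_insert J(1) by blast
    with max[of "insert y J"] y J show False by auto
  qed
  with J that show ?thesis by blast
qed

text \<open>By (R3) \<open>card I\<close> is at most \<open>\<rho> J + \<rho> (I - J)\<close>, while
  (R1) bounds each summand by a cardinality; both bounds must be attained.\<close>

lemma indep_subset:
  assumes "indep I" "J \<subseteq> I"
  shows "indep J"
proof -
  have mem: "J \<in> \<C>" "I - J \<in> \<C>" "I \<in> \<C>" "{} \<in> \<C>"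
    using assms by (auto simp: indep_def intro: down_closed)
  have "J \<union> (I - J) = I" "J \<inter> (I - J) = {}" using assms by auto
  then have "card I \<le> \<rho> J + \<rho> (I - J)"
    using R3[of J "I - J"] mem assms(1) by (simp add: indep_def)
  moreover have "card I = card J + card (I - J)"
    using assms finite_member[OF mem(3)] by (metis card_Diff_subset card_mono finite_subset
        le_add_diff_inverse)
  ultimately show ?thesis using R1[OF mem(1)] R1[OF mem(2)] mem by (simp add: indep_def)
qed

lemma indep_empty: "indep {}"
proof -
  have "{} \<in> \<C>" using nonempty by (auto intro: down_closed)
  then show ?thesis using R1[of "{}"] by (simp add: indep_def)
qed

section \<open>Bases and exchange\<close>

lemma basis_iff: "basis B \<longleftrightarrow> indep B \<and> card B = rank"
  by (auto simp: basis_def indep_def)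

lemma basis_mem: "basis B \<Longrightarrow> B \<in> \<C>"
  by (simp add: basis_def)

lemma finite_basis: "basis B \<Longrightarrow> finite B"
  using basis_mem finite_member by blast

lemma augment_to_basis:
  assumes "indep I" "Y \<in> \<C>" "\<rho> Y = rank"
  obtains B where "basis B" "I \<subseteq> B" "B \<subseteq> I \<union> Y"
proof -
  obtain J where "indep J" "I \<subseteq> J" "J \<subseteq> I \<union> Y" "\<rho> Y \<le> \<rho> J"
    using augment[OF assms(1,2)] .
  with assms rank_ge[of J] that[of J] show ?thesis by (auto simp: basis_iff indep_def)
qed

lemma ex_basis: "\<exists>B. basis B"
proof -
  obtain Y where "Y \<in> \<C>" "\<rho> Y = rank"
    using ex_maximal nonempty rank_maximal by (metis all_not_in_conv maximal_def)
  then show ?thesis using augment_to_basis[OF indep_empty] by blast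
qed

text \<open>A basis between \<open>I\<close> and \<open>I \<union> B\<close> has \<open>e\<close> as
  its only element outside \<open>B\<close>; equal cardinalities make it omit exactly one element
  \<open>f\<close> of \<open>B\<close>. The choice of \<open>I\<close> controls which elements
  survive the exchange.\<close>

lemma exchange_in:
  assumes "basis B" "indep I" "e \<in> I" "e \<notin> B" "I - {e} \<subseteq> B"
  obtains f where "f \<in> B - I" "basis (insert e (B - {f}))"
proof -
  obtain B' where B': "basis B'" "I \<subseteq> B'" "B' \<subseteq> I \<union> B"
    using augment_to_basis[OF assms(2), of B] assms(1) by (auto simp: basis_def)
  have fin: "finite B" "finite B'" using assms(1) B'(1) finite_basis by auto
  have "card (B' - B) = card (B - B')"
    using fin assms(1) B'(1) card_le_sym_Diff[of B B'] card_le_sym_Diff[of B' B]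
    by (simp add: basis_iff)
  moreover have "B' - B = {e}" using B' assms by auto
  ultimately have "card (B - B') = 1" by simp
  then obtain f where f: "B - B' = {f}" by (auto simp: card_1_singleton_iff)
  then have "B' = insert e (B - {f})" using \<open>B' - B = {e}\<close> by auto
  moreover have "f \<in> B - I" using f B' by auto
  ultimately show ?thesis using that B'(1) by blast
qed

lemma exchange_out:
  assumes "basis B" "basis B'" "i \<in> B" "i \<notin> B'"
  obtains x where "x \<in> B' - B" "basis (insert x (B - {i}))"
proof -
  have "indep (B - {i})" using assms(1) indep_subset by (auto simp: basis_iff)
  then obtain J where J: "basis J" "B - {i} \<subseteq> J" "J \<subseteq> (B - {i}) \<union> B'"
    using augment_to_basis[of "B - {i}" B'] assms(2) by (auto simp: basis_def)
  have fin: "finite B" "finite J" using assms(1) J(1) finite_basis by auto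
  have "card (J - B) = card (B - J)"
    using fin assms(1) J(1) card_le_sym_Diff[of B J] card_le_sym_Diff[of J B]
    by (simp add: basis_iff)
  moreover have "B - J = {i}" using J assms by auto
  ultimately have "card (J - B) = 1" by simp
  then obtain x where x: "J - B = {x}" by (auto simp: card_1_singleton_iff)
  then have "J = insert x (B - {i})" using \<open>B - J = {i}\<close> by auto
  moreover have "x \<in> B' - B" using x J by auto
  ultimately show ?thesis using that J(1) by blast
qed

section \<open>Fundamental circuits and cocircuits\<close>

text \<open>No dependent set lies in a basis. For one inside \<open>insert e B\<close>, the basis
  \<open>B\<close> forces \<open>e\<close> into it and each basis \<open>insert e (B - {b})\<close>
  forces \<open>b\<close>. Conversely, were the right-hand side independent,
  \<open>exchange_in\<close> would trade some \<open>f\<close> outside it for \<open>e\<close>,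
  which its definition excludes.\<close>

lemma fund_circuit_eq:
  assumes "basis B" "e \<notin> B" "insert e B \<in> \<C>"
  shows "fund_circuit B e = insert e {b \<in> B. basis (insert e (B - {b}))}" (is "_ = ?K")
proof -
  have K: "?K \<in> \<C>" using assms(3) by (rule down_closed) auto
  have least: "?K \<subseteq> X" if X: "dependent X" "X \<subseteq> insert e B" for X
  proof -
    have not: "\<not> X \<subseteq> J" if "basis J" for J
    proof
      assume "X \<subseteq> J"
      then have "indep X" using indep_subset[of J X] that by (simp add: basis_iff)
      with X(1) show False by (simp add: indep_def dependent_def)
    qed
    have "e \<in> X" using not[OF assms(1)] X(2) by auto
    moreover have "b \<in> X" if "b \<in> B" "basis (insert e (B - {b}))" for b
      using not[OF that(2)] X(2) by auto
    ultimately show ?thesis by auto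
  qed
  have "\<not> indep ?K"
  proof
    assume "indep ?K"
    then obtain f where "f \<in> B - ?K" "basis (insert e (B - {f}))"
      using exchange_in[OF assms(1), of ?K e] assms(2) by auto
    then show False by auto
  qed
  then have "dependent ?K" using K R1[OF K] by (auto simp: dependent_def indep_def)
  show ?thesis unfolding fund_circuit_def
  proof (rule the_equality)
    have sub: "?K \<subseteq> insert e B" by auto
    then have "X = ?K" if "dependent X" "X \<subseteq> ?K" for X
      using least[OF that(1)] that(2) by (meson subset_antisym subset_trans)
    then show "circuit ?K \<and> ?K \<subseteq> B \<union> {e}"
      using \<open>dependent ?K\<close> sub unfolding circuit_def by simp
    show "K' = ?K" if K': "circuit K' \<and> K' \<subseteq> B \<union> {e}" for K'
    proof -
      have "?K \<subseteq> K'" using K' least[of K'] by (simp add: circuit_def)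
      with K' \<open>dependent ?K\<close> show ?thesis unfolding circuit_def by blast
    qed
  qed
qed

text \<open>Turns cocircuits into minimal sets meeting every basis: a member of full rank contains a
  basis, by augmenting \<open>{}\<close> inside it.\<close>

lemma r_less_rank_iff: "r A < rank \<longleftrightarrow> (\<forall>B \<subseteq> A. \<not> basis B)"
proof -
  let ?R = "{\<rho> Y | Y. Y \<subseteq> A \<and> Y \<in> \<C>}"
  have fin: "finite ?R" using finite_complex by simp
  have "{} \<in> \<C>" using indep_empty by (simp add: indep_def)
  then have ne: "?R \<noteq> {}" by auto
  have "r A < rank \<longleftrightarrow> (\<forall>Y. Y \<subseteq> A \<and> Y \<in> \<C> \<longrightarrow> \<rho> Y < rank)"
    unfolding r_def using Max_less_iff[OF fin ne] by auto
  also have "\<dots> \<longleftrightarrow> (\<forall>B \<subseteq> A. \<not> basis B)"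
  proof
    assume "\<forall>Y. Y \<subseteq> A \<and> Y \<in> \<C> \<longrightarrow> \<rho> Y < rank"
    then show "\<forall>B \<subseteq> A. \<not> basis B" by (auto simp: basis_def)
  next
    assume no: "\<forall>B \<subseteq> A. \<not> basis B"
    show "\<forall>Y. Y \<subseteq> A \<and> Y \<in> \<C> \<longrightarrow> \<rho> Y < rank"
    proof (intro allI impI)
      fix Y assume Y: "Y \<subseteq> A \<and> Y \<in> \<C>"
      have "\<rho> Y \<noteq> rank"
      proof
        assume "\<rho> Y = rank"
        then obtain B where "basis B" "B \<subseteq> {} \<union> Y"
          using augment_to_basis[OF indep_empty, of Y] Y by auto
        with no Y show False by auto
      qed
      with rank_ge[of Y] Y show "\<rho> Y < rank" by simp
    qed
  qed
  finally show ?thesis .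
qed

text \<open>A subset of \<open>insert i (S - B)\<close> that meets all bases contains
  \<open>i\<close> because of \<open>B\<close>, and \<open>x\<close> because of
  \<open>insert x (B - {i})\<close>. Conversely, a basis avoiding the right-hand side lacks
  \<open>i\<close>, and \<open>exchange_out\<close> finds one of its elements in that very
  set.\<close>

lemma fund_cocircuit_eq:
  assumes "basis B" "i \<in> B"
  shows "fund_cocircuit B i = insert i {x \<in> S - B. basis (insert x (B - {i}))}" (is "_ = ?D")
proof -
  have BS: "B \<subseteq> S" using assms(1) basis_mem subset_ground by blast
  have least: "?D \<subseteq> X" if X: "X \<subseteq> insert i (S - B)" "r (S - X) < rank" for X
  proof -
    have not: "\<not> J \<subseteq> S - X" if "basis J" for J
      using X(2) that by (auto simp: r_less_rank_iff)
    show ?thesis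
    proof
      fix x assume "x \<in> ?D"
      then show "x \<in> X"
      proof
        assume "x = i"
        then show ?thesis using not[OF assms(1)] X(1) BS by auto
      next
        assume "x \<in> {x \<in> S - B. basis (insert x (B - {i}))}"
        then show ?thesis using not[of "insert x (B - {i})"] X(1) BS by auto
      qed
    qed
  qed
  have low: "r (S - ?D) < rank"
    unfolding r_less_rank_iff
  proof (intro allI impI notI)
    fix B' assume B': "B' \<subseteq> S - ?D" "basis B'"
    then obtain x where "x \<in> B' - B" "basis (insert x (B - {i}))"
      using exchange_out[OF assms(1) B'(2) assms(2)] by auto
    with B' show False by auto
  qed
  show ?thesis unfolding fund_cocircuit_def
  proof (rule the_equality)
    have sub: "?D \<subseteq> insert i (S - B)" "?D \<subseteq> S" using BS assms(2) by auto
    have "D' = ?D" if "D' \<subseteq> ?D" "r (S - D') < rank" for D'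
      using least[of D'] that sub(1) by (meson subset_antisym subset_trans)
    then show "cocircuit ?D \<and> ?D \<subseteq> S - B \<union> {i}"
      using low sub unfolding cocircuit_def by simp
    show "D = ?D" if D: "cocircuit D \<and> D \<subseteq> S - B \<union> {i}" for D
    proof -
      have "?D \<subseteq> D" using D least[of D] by (simp add: cocircuit_def)
      with D low show ?thesis unfolding cocircuit_def by blast
    qed
  qed
qed

section \<open>Existence and uniqueness of optimal bases\<close>

lemma ex_optimal: "\<exists>B. optimal w B" if "inj_on w S"
proof -
  have "finite {B. basis B}" using finite_complex by (rule rev_finite_subset) (auto simp: basis_def)
  \<comment> \<open>\<open>B\<close> minimises the total weight; exchanging \<open>b\<close> for
    \<open>x\<close> changes the total by \<open>w x - w b\<close>, and injectivity makes the
    inequality strict.\<close>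
  then obtain B where B: "basis B" and min: "\<And>B'. basis B' \<Longrightarrow> sum w B \<le> sum w B'"
    using ex_basis ex_min_if_finite[of "(sum w) ` {B. basis B}"]
    by (fastforce simp: not_less)
  have "w b < w x" if x: "b \<in> B" "x \<notin> B" "basis (insert x (B - {b}))" for b x
  proof -
    have fin: "finite B" using B finite_basis by blast
    have "sum w B = w b + sum w (B - {b})" using fin x by (simp add: sum.remove)
    moreover have "sum w (insert x (B - {b})) = w x + sum w (B - {b})" using fin x by simp
    ultimately have "w b \<le> w x" using min[OF x(3)] by simp
    moreover have "b \<in> S" "x \<in> S" using B x basis_mem subset_ground by blast+
    ultimately show ?thesis using \<open>inj_on w S\<close> x by (metis inj_onD order_le_less)
  qed
  with B show ?thesis by (auto simp: optimal_def)
qed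

lemma optimal_Diff_greater:
  assumes "optimal w B" "optimal w B'" "e \<in> B' - B"
  shows "\<exists>f \<in> B - B'. w f < w e"
proof -
  \<comment> \<open>Keeping \<open>B \<inter> B'\<close> inside the independent set protects it, so
    the element \<open>f\<close> that is swapped out lies outside \<open>B'\<close>.\<close>
  have "basis B" "indep (insert e (B \<inter> B'))" "e \<notin> B" "insert e (B \<inter> B') - {e} \<subseteq> B"
    using assms indep_subset[of B'] by (auto simp: optimal_def basis_iff)
  then obtain f where "f \<in> B - insert e (B \<inter> B')" "basis (insert e (B - {f}))"
    using exchange_in[of B "insert e (B \<inter> B')" e] by blast
  with assms show ?thesis by (auto simp: optimal_def)
qed

text \<open>An element of least weight in the symmetric difference would be undercut by an element
  of the other basis.\<close>

lemma optimal_unique: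
  assumes "optimal w B" "optimal w B'"
  shows "B = B'"
proof (rule ccontr)
  assume "B \<noteq> B'"
  let ?A = "(B - B') \<union> (B' - B)"
  have "finite ?A" "?A \<noteq> {}"
    using assms \<open>B \<noteq> B'\<close> finite_basis by (auto simp: optimal_def)
  note e = arg_min_if_finite[OF this, of w]
  then have "\<exists>f \<in> ?A. w f < w (arg_min_on w ?A)"
    using optimal_Diff_greater[OF assms] optimal_Diff_greater[OF assms(2,1)] by (meson UnCI UnE)
  with e(2) show False by blast
qed

section \<open>Rank and membership relative to a basis\<close>

text \<open>Prepares (CR1) for \<open>X\<close> and \<open>B\<close>. If the ranks differed,
  \<open>X \<inter> B\<close> could be augmented by some \<open>x\<close> in \<open>X - B\<close>,
  and \<open>exchange_in\<close> would trade an element of \<open>B - X\<close> for it.\<close>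

lemma rank_Int_eq:
  assumes "basis B" "X \<in> \<C>"
    and "\<And>b x. b \<in> B - X \<Longrightarrow> x \<in> X - B \<Longrightarrow> \<not> basis (insert x (B - {b}))"
  shows "\<rho> X = \<rho> (X \<inter> B)"
proof (rule ccontr)
  assume ne: "\<rho> X \<noteq> \<rho> (X \<inter> B)"
  have ind: "indep (X \<inter> B)" using assms(1) indep_subset by (auto simp: basis_iff)
  have "\<rho> (X \<inter> B) < \<rho> X"
    using ne R2[of "X \<inter> B" X] ind assms(2) by (simp add: indep_def)
  then obtain x where x: "x \<in> X - (X \<inter> B)" "insert x (X \<inter> B) \<in> \<C>"
      "\<rho> (X \<inter> B) < \<rho> (insert x (X \<inter> B))"
    using augment_step[of "X \<inter> B" X] ind assms(2) by (auto simp: indep_def)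
  moreover from this have "x \<notin> B" "insert x (X \<inter> B) - {x} \<subseteq> B" by auto
  ultimately obtain f where "f \<in> B - insert x (X \<inter> B)" "basis (insert x (B - {f}))"
    using exchange_in[OF assms(1) indep_insert[OF ind x(2,3)], of x] by blast
  with assms(3)[of f x] x show False by auto
qed

text \<open>Adjoining \<open>e\<close> to a basis cannot raise the rank, and for new
  \<open>e\<close> the sets \<open>insert e B\<close> and \<open>B \<union> E\<close> meet in
  \<open>B\<close>, so (CR1) puts their union into \<open>\<C>\<close>.\<close>

lemma union_mem:
  assumes "basis B" "finite E" "\<And>e. e \<in> E \<Longrightarrow> insert e B \<in> \<C>"
  shows "B \<union> E \<in> \<C>"
  using assms(2,3)
proof induction
  case empty
  then show ?case using assms(1) basis_mem by simp
next
  case (insert e E)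
  then have mem: "insert e B \<in> \<C>" "B \<union> E \<in> \<C>" by auto
  show ?case
  proof (cases "e \<in> B")
    case True
    then show ?thesis using mem by (simp add: insert_absorb)
  next
    case False
    then have "insert e B \<inter> (B \<union> E) = B" using insert by auto
    moreover have "\<rho> (insert e B) = \<rho> B"
      using rank_ge[OF mem(1)] R2[OF basis_mem[OF assms(1)] mem(1)] assms(1)
      by (simp add: basis_def subset_insertI)
    ultimately have "insert e B \<union> (B \<union> E) \<in> \<C>" using CR1[OF mem] by simp
    then show ?thesis by simp
  qed
qed

end

section \<open>Activities and the weight attached to a set\<close>

locale weighted_semimatroid = semimatroid +
  fixes le :: "'a rel" and p :: "'a \<Rightarrow> int"
  assumes p_pos: "a \<in> S \<Longrightarrow> 0 < p a"
    and le_iff: "a \<in> S \<Longrightarrow> b \<in> S \<Longrightarrow> (a, b) \<in> le \<longleftrightarrow> p a \<le> p b"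
    and p_inj: "inj_on p S"
begin

text \<open>As \<open>p\<close> is positive on \<open>S\<close>, the sign both puts \<open>X\<close>
  first and reverses the order within it.\<close>

definition weight :: "'a set \<Rightarrow> 'a \<Rightarrow> int" where
  "weight X x = (if x \<in> X then - p x else p x)"

lemma ext_active_iff:
  assumes "basis B"
  shows "ext_active le B e \<longleftrightarrow> e \<in> S - B \<and> insert e B \<in> \<C> \<and>
    (\<forall>b\<in>B. basis (insert e (B - {b})) \<longrightarrow> p e \<le> p b)"
proof -
  have "B \<subseteq> S" using assms basis_mem subset_ground by blast
  then show ?thesis
    using fund_circuit_eq[OF assms, of e]
    by (auto simp: ext_active_def smallest_def le_iff subset_iff)
qed

lemma int_active_iff:
  assumes "basis B"
  shows "int_active le B i \<longleftrightarrow> i \<in> B \<and>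
    (\<forall>x. x \<notin> B \<and> basis (insert x (B - {i})) \<longrightarrow> p i \<le> p x)"
proof -
  have "B \<subseteq> S" using assms basis_mem subset_ground by blast
  moreover have "x \<in> S" if "basis (insert x (B - {i}))" for x
    using basis_mem[OF that] subset_ground by blast
  ultimately show ?thesis
    using fund_cocircuit_eq[OF assms, of i]
    by (auto simp: int_active_def smallest_def le_iff subset_iff)
qed

lemma inj_weight: "inj_on (weight X) S"
proof (rule inj_onI)
  fix x y assume "x \<in> S" "y \<in> S" "weight X x = weight X y"
  then show "x = y"
    using p_pos[of x] p_pos[of y] inj_onD[OF p_inj, of x y] by (auto simp: weight_def split: if_splits)
qed

lemma optimal_weight_iff:
  assumes "basis B" "X \<in> \<C>"
  shows "optimal (weight X) B \<longleftrightarrow>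
    B - X \<subseteq> {i. int_active le B i} \<and> X - B \<subseteq> {e. ext_active le B e}" (is "_ \<longleftrightarrow> ?I \<and> ?E")
proof
  assume opt: "optimal (weight X) B"
  have less: "weight X b < weight X x" if "b \<in> B" "x \<notin> B" "basis (insert x (B - {b}))" for b x
    using opt that by (auto simp: optimal_def)
  have BS: "B \<subseteq> S" "X \<subseteq> S" using assms basis_mem subset_ground by blast+
  then have pos: "0 < p y" if "y \<in> B \<union> X" for y using p_pos that by blast
  \<comment> \<open>Such an exchange would replace a positive weight by a negative one, against
    optimality.\<close>
  have cross: "\<not> basis (insert x (B - {b}))" if "b \<in> B - X" "x \<in> X - B" for b x
    using less[of b x] that pos[of b] pos[of x] by (auto simp: weight_def)
  \<comment> \<open>External activity demands \<open>insert x B \<in> \<C>\<close>; (CR1) yields it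
    for all \<open>x\<close> in \<open>X\<close> at once.\<close>
  have "X \<union> B \<in> \<C>"
    using CR1[of X B] rank_Int_eq[OF assms cross] assms basis_mem by simp
  then have "insert x B \<in> \<C>" if "x \<in> X" for x
    using that by (auto intro: down_closed)
  moreover have "p x \<le> p b" if "x \<in> X - B" "b \<in> B" "basis (insert x (B - {b}))" for x b
    using less[of b x] cross[of b x] that by (auto simp: weight_def split: if_splits)
  ultimately have ?E using BS by (auto simp: ext_active_iff[OF assms(1)])
  moreover have "p b \<le> p x" if "b \<in> B - X" "x \<notin> B" "basis (insert x (B - {b}))" for x b
    using less[of b x] cross[of b x] that by (auto simp: weight_def split: if_splits)
  then have ?I by (auto simp: int_active_iff[OF assms(1)])
  ultimately show "?I \<and> ?E" by simp
next
  assume "?I \<and> ?E"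
  then have I: "p b \<le> p x" if "b \<in> B - X" "x \<notin> B" "basis (insert x (B - {b}))" for b x
    using that int_active_iff[OF assms(1)] by blast
  have E: "p x \<le> p b" if "x \<in> X - B" "b \<in> B" "basis (insert x (B - {b}))" for b x
    using that \<open>?I \<and> ?E\<close> ext_active_iff[OF assms(1)] by blast
  have "weight X b < weight X x" if x: "b \<in> B" "x \<notin> B" "basis (insert x (B - {b}))" for b x
  proof -
    have S: "b \<in> S" "x \<in> S" using x assms(1) basis_mem subset_ground by blast+
    then have "p b \<noteq> p x" using inj_onD[OF p_inj] x by blast
    \<comment> \<open>For \<open>b\<close> outside and \<open>x\<close> inside \<open>X\<close>,
      \<open>I\<close> and \<open>E\<close> together would give \<open>p b = p x\<close>; for
      \<open>b\<close> inside and \<open>x\<close> outside, the signs decide.\<close>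
    then show ?thesis using I[of b x] E[of x b] x p_pos[OF S(1)] p_pos[OF S(2)]
      by (cases "b \<in> X"; cases "x \<in> X") (simp_all add: weight_def)
  qed
  then show "optimal (weight X) B" using assms(1) by (auto simp: optimal_def)
qed

text \<open>Membership comes from \<open>union_mem\<close>, and optimality then from
  \<open>optimal_weight_iff\<close>. Optimality in turn excludes trading an element of
  \<open>I\<close> for one of \<open>E\<close>, so the rank is that of the independent set
  \<open>B - I\<close>.\<close>

lemma interval_member:
  assumes "basis B" "I \<subseteq> {i. int_active le B i}" "E \<subseteq> {e. ext_active le B e}"
  shows "(B - I) \<union> E \<in> \<C>" and "optimal (weight ((B - I) \<union> E)) B"
    and "\<rho> ((B - I) \<union> E) = card (B - I)"
proof -
  let ?X = "(B - I) \<union> E"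
  have IE: "I \<subseteq> B" "E \<subseteq> S - B" using assms(2,3) by (auto simp: int_active_def ext_active_def)
  have "finite E" using IE(2) finite_ground finite_subset by blast
  moreover have "insert e B \<in> \<C>" if "e \<in> E" for e
    using that assms(3) ext_active_iff[OF assms(1)] by blast
  ultimately have "B \<union> E \<in> \<C>" by (rule union_mem[OF assms(1)])
  then show X: "?X \<in> \<C>" by (rule down_closed) auto
  show opt: "optimal (weight ?X) B"
    unfolding optimal_weight_iff[OF assms(1) X] using assms(2,3) IE by auto
  have S: "B \<subseteq> S" "?X \<subseteq> S" using X assms(1) basis_mem subset_ground by blast+
  then have pos: "0 < p y" if "y \<in> B \<union> ?X" for y using p_pos that by blast
  have "\<rho> ?X = \<rho> (?X \<inter> B)"
  proof (rule rank_Int_eq[OF assms(1) X])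
    fix b x assume "b \<in> B - ?X" "x \<in> ?X - B"
    moreover from this have "\<not> weight ?X b < weight ?X x"
      using pos[of b] pos[of x] by (auto simp: weight_def)
    ultimately show "\<not> basis (insert x (B - {b}))" using opt by (auto simp: optimal_def)
  qed
  moreover have "?X \<inter> B = B - I" using IE by auto
  moreover have "indep (B - I)" using assms(1) indep_subset by (auto simp: basis_iff)
  ultimately show "\<rho> ?X = card (B - I)" by (simp add: indep_def)
qed

section \<open>Summation over the blocks of the partition\<close>

text \<open>The members \<open>X\<close> with optimal basis \<open>B\<close> correspond to pairs
  \<open>(I, E)\<close> of sets of active elements via \<open>I = B - X\<close> and
  \<open>E = X - B\<close>. As \<open>\<rho> X = card (B - I)\<close>, the exponents become
  \<open>card I\<close> and \<open>card E\<close>, and the sum factors.\<close>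

lemma sum_optimal:
  fixes q t :: "'b::comm_ring_1"
  assumes "basis B"
  shows "(\<Sum>X | X \<in> \<C> \<and> optimal (weight X) B. (q - 1) ^ (rank - \<rho> X) * (t - 1) ^ (card X - \<rho> X)) =
    q ^ int_activity le B * t ^ ext_activity le B"
proof -
  let ?IA = "{i. int_active le B i}" and ?EA = "{e. ext_active le B e}"
  have sub: "?IA \<subseteq> B" "?EA \<subseteq> S - B" by (auto simp: int_active_def ext_active_def)
  have finB: "finite B" using assms by (rule finite_basis)
  have fin: "finite ?IA" "finite ?EA"
    using finite_subset[OF sub(1) finB] finite_subset[OF sub(2)] finite_ground by auto
  have "(\<Sum>X | X \<in> \<C> \<and> optimal (weight X) B. (q - 1) ^ (rank - \<rho> X) * (t - 1) ^ (card X - \<rho> X)) =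
    (\<Sum>(I, E)\<in>Pow ?IA \<times> Pow ?EA. (q - 1) ^ card I * (t - 1) ^ card E)"
  proof (rule sum.reindex_bij_witness[where i = "\<lambda>(I, E). (B - I) \<union> E" and j = "\<lambda>X. (B - X, X - B)"])
    fix X assume "X \<in> {X. X \<in> \<C> \<and> optimal (weight X) B}"
    then have X: "B - X \<subseteq> ?IA" "X - B \<subseteq> ?EA" using optimal_weight_iff[OF assms] by auto
    have eq: "(B - (B - X)) \<union> (X - B) = X" by auto
    then show "(case (B - X, X - B) of (I, E) \<Rightarrow> (B - I) \<union> E) = X" by simp
    show "(B - X, X - B) \<in> Pow ?IA \<times> Pow ?EA" using X by simp
    have \<rho>: "\<rho> X = card (B - (B - X))" using interval_member(3)[OF assms X] eq by simp
    have finX: "finite (X - B)" using X(2) fin(2) finite_subset by blast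
    have "card B = card (B - (B - X)) + card (B - X)"
      using finB by (subst card_Un_disjoint[symmetric]) (auto intro: arg_cong[of _ _ card])
    then have 1: "rank - \<rho> X = card (B - X)" using \<rho> assms unfolding basis_iff by linarith
    have "card X = card (B - (B - X)) + card (X - B)"
      using finB finX by (subst card_Un_disjoint[symmetric]) (auto simp: eq)
    then have 2: "card X - \<rho> X = card (X - B)" using \<rho> by linarith
    show "(case (B - X, X - B) of (I, E) \<Rightarrow> (q - 1) ^ card I * (t - 1) ^ card E) =
      (q - 1) ^ (rank - \<rho> X) * (t - 1) ^ (card X - \<rho> X)"
      by (simp add: 1 2)
  next
    fix IE assume "IE \<in> Pow ?IA \<times> Pow ?EA"
    then obtain I E where IE: "IE = (I, E)" "I \<subseteq> ?IA" "E \<subseteq> ?EA" by auto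
    then show "(case IE of (I, E) \<Rightarrow> (B - I) \<union> E) \<in> {X. X \<in> \<C> \<and> optimal (weight X) B}"
      using interval_member[OF assms IE(2,3)] by simp
    show "(B - (case IE of (I, E) \<Rightarrow> (B - I) \<union> E), (case IE of (I, E) \<Rightarrow> (B - I) \<union> E) - B) = IE"
      using IE sub by auto
  qed
  also have "\<dots> = (\<Sum>I\<in>Pow ?IA. (q - 1) ^ card I) * (\<Sum>E\<in>Pow ?EA. (t - 1) ^ card E)"
    by (simp add: sum_product sum.cartesian_product)
  also have "\<dots> = q ^ int_activity le B * t ^ ext_activity le B"
    by (simp add: sum_Pow_power_card fin int_activity_def ext_activity_def)
  finally show ?thesis .
qed

lemma tutte_eq_sum_activities:
  fixes q t :: "'b::comm_ring_1"
  shows "tutte q t = (\<Sum>B | basis B. q ^ int_activity le B * t ^ ext_activity le B)"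
proof -
  let ?f = "\<lambda>X. (q - 1) ^ (rank - \<rho> X) * (t - 1) ^ (card X - \<rho> X)"
  have fin: "finite {B. basis B}"
    using finite_complex by (rule rev_finite_subset) (auto simp: basis_def)
  \<comment> \<open>Each member \<open>X\<close> falls into the block of the basis that is optimal
    for its own weight \<open>weight X\<close>; \<open>optimal_unique\<close> makes the blocks
    disjoint.\<close>
  have "\<C> = (\<Union>B\<in>{B. basis B}. {X. X \<in> \<C> \<and> optimal (weight X) B})" (is "_ = ?U")
    using ex_optimal[OF inj_weight] by (fastforce simp: optimal_def)
  then have "tutte q t = sum ?f ?U" unfolding tutte_def by (rule sum.cong) simp
  also have "\<dots> = (\<Sum>B | basis B. \<Sum>X | X \<in> \<C> \<and> optimal (weight X) B. ?f X)"
    by (rule sum.UNION_disjoint) (use fin finite_complex optimal_unique in auto)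
  also have "\<dots> = (\<Sum>B | basis B. q ^ int_activity le B * t ^ ext_activity le B)"
    by (rule sum.cong) (auto simp: sum_optimal)
  finally show ?thesis .
qed

end

theorem theorem9p5:
  fixes S :: "'a set" and \<C> :: "'a set set" and \<rho> :: "'a set \<Rightarrow> nat"
    and le :: "'a rel" and q t :: "'b::comm_ring_1"
  assumes "semimatroid S \<C> \<rho>"
    and "linear_order_on S le"
  shows "semimatroid.tutte \<C> \<rho> q t =
    (\<Sum>B | semimatroid.basis \<C> \<rho> B.
       q ^ semimatroid.int_activity S \<C> \<rho> le B * t ^ semimatroid.ext_activity S \<C> \<rho> le B)"
proof -
  interpret semimatroid S \<C> \<rho> by (rule assms(1))
  obtain p :: "'a \<Rightarrow> int" where "weighted_semimatroid S \<C> \<rho> le p"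
    by (rule linear_order_weight[OF finite_ground assms(2)])
      (blast intro: weighted_semimatroid.intro weighted_semimatroid_axioms.intro semimatroid_axioms)
  then interpret weighted_semimatroid S \<C> \<rho> le p .
  show ?thesis by (rule tutte_eq_sum_activities)
qed

end
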